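(* Let $M^2_1$ be a minimal Lorentz surface of general type in $\mathbb{E}^4_2$, with $K^2-\varkappa^2>0$, parametrized by canonical parameters $(u,v)$, and let $\varepsilon=\langle n_1,n_1\rangle=\pm1$, where $n_1$ is the geometric normal vector field of $M^2_1$. Then the Gauss curvature $K$ and the normal curvature $\varkappa$ of $M^2_1$ satisfy the system of partial differential equations $$\sqrt[4]{K^2-\varkappa^2}\;\Delta^h\ln(K^2-\varkappa^2)=8K,$$ $$\sqrt[4]{K^2-\varkappa^2}\;\Delta^h\ln\frac{K+\varepsilon\,\varkappa}{K-\varepsilon\,\varkappa}=4\varepsilon\,\varkappa,$$ where $\Delta^h=\frac{\partial^2}{\partial u^2}-\frac{\partial^2}{\partial v^2}$.
   Context: $\mathbb{E}^4_2$ is $\mathbb{R}^4$ with the flat metric $g_0=dx_1^2+dx_2^2-dx_3^2-dx_4^2$, with inner product $\langle\cdot,\cdot\rangle$. A surface $M^2_1$ in $\mathbb{E}^4_2$ is Lorentz if the induced metric has signature $(1,1)$ (the normal planes then also have signature $(1,1)$). Let $\sigma$ be the second fundamental form; $M^2_1$ is minimal if its mean curvature vector $H=\frac12\operatorname{tr}\sigma$ vanishes identically; for a tangent frame with $\langle x,x\rangle=1$, $\langle x,y\rangle=0$, $\langle y,y\rangle=-1$ this means $\sigma(x,x)=\sigma(y,y)$. The first normal space at $p$ is $\operatorname{span}\{\sigma(X,Y):X,Y\in T_pM^2_1\}$. The Gauss curvature is $$K=\frac{\langle\sigma(x,x),\sigma(y,y)\rangle-\langle\sigma(x,y),\sigma(x,y)\rangle}{\langle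 x,x\rangle\langle y,y\rangle-\langle x,y\rangle^2},$$ and the normal curvature is $$\varkappa=\frac{\langle R^\perp(x,y)n_1,n_2\rangle}{\langle x,x\rangle\langle y,y\rangle-\langle x,y\rangle^2},$$ where $R^\perp(x,y)n_1=D_xD_yn_1-D_yD_xn_1-D_{[x,y]}n_1$, $D$ is the normal connection and $\{n_1,n_2\}$ is an orthonormal normal frame (changing this frame changes $\varkappa$ at most by sign; when a geometric frame field, defined below, is available, $\varkappa$ is computed with it). A minimal Lorentz surface is of general type if its first normal space is two-dimensional at each point and $K^2-\varkappa^2>0$ on a dense open subset. A geometric frame field of a minimal Lorentz surface of general type is an orthonormal frame field $\{x,y,n_1,n_2\}$, with $x,y$ tangent and $n_1,n_2$ normal, $\langle x,x\rangle=1$, $\langle y,y\rangle=-1$, $\langle n_1,n_1\rangle=\varepsilon$, $\langle n_2,n_2\rangle=-\varepsilon$ ($\varepsilon=\pm1$), such that $$\sigma(x,x)=\sigma(y,y)=\nu\,n_1,\qquad \sigma(x,y)=\mu\,n_2$$ with functions $\mu,\nu$, $\mu\nu\neq0$; $n_1$ is called the geometric normal vector field. Parameters $(u,v)$ of the surface $z=z(u,v)$ are canonical if $z_u=\sqrt{E}\,x$, $z_v=\sqrt{-G}\,y$ for the geometric frame field, where $$E=\langle z_u,z_u\rangle=\frac{1}{\sqrt{|\mu^2-\nu^2|}},\quad F=\langle z_u,z_v\rangle=0,\quad G=\langle z_v,z_v\rangle=-\frac{1}{\sqrt{|\mu^2-\nu^2|}}.$$ *)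

theory Defs
  imports "HOL-Analysis.Analysis"
begin

(* The pseudo-Euclidean space E^4_2. *)
definition ip :: "real ^ 4 \<Rightarrow> real ^ 4 \<Rightarrow> real" where
  "ip a b = a $ 1 * b $ 1 + a $ 2 * b $ 2 - a $ 3 * b $ 3 - a $ 4 * b $ 4"

(* Functions of the parameters (u, v) are functions on real \<times> real. *)
definition pd_u :: "(real \<times> real \<Rightarrow> 'a::real_normed_vector) \<Rightarrow> real \<times> real \<Rightarrow> 'a" where
  "pd_u f p = vector_derivative (\<lambda>s. f (s, snd p)) (at (fst p))"

definition pd_v :: "(real \<times> real \<Rightarrow> 'a::real_normed_vector) \<Rightarrow> real \<times> real \<Rightarrow> 'a" where
  "pd_v f p = vector_derivative (\<lambda>t. f (fst p, t)) (at (snd p))"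

definition hyp_laplacian :: "(real \<times> real \<Rightarrow> real) \<Rightarrow> real \<times> real \<Rightarrow> real" where
  "hyp_laplacian f p = pd_u (pd_u f) p - pd_v (pd_v f) p"

(* Used for open U only. *)
primrec Ck_on :: "nat \<Rightarrow> (real \<times> real) set \<Rightarrow> (real \<times> real \<Rightarrow> 'a::real_normed_vector) \<Rightarrow> bool" where
  "Ck_on 0 U f \<longleftrightarrow> continuous_on U f"
| "Ck_on (Suc k) U f \<longleftrightarrow> f differentiable_on U \<and> Ck_on k U (pd_u f) \<and> Ck_on k U (pd_v f)"

definition smooth_on :: "(real \<times> real) set \<Rightarrow> (real \<times> real \<Rightarrow> 'a::real_normed_vector) \<Rightarrow> bool" where
  "smooth_on U f \<longleftrightarrow> (\<forall>k. Ck_on k U f)"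

(* A surface is given by a parametrization z. Vector fields on it, tangent or normal, are
   maps from the parameters to the ambient space; X p is a vector at the point z p. *)
type_synonym field = "real \<times> real \<Rightarrow> real ^ 4"

abbreviation differential :: "field \<Rightarrow> real \<times> real \<Rightarrow> real \<times> real \<Rightarrow> real ^ 4" where
  "differential z p \<equiv> frechet_derivative z (at p)"

definition tangent_space :: "field \<Rightarrow> real \<times> real \<Rightarrow> (real ^ 4) set" where
  "tangent_space z p = range (differential z p)"

definition normal_space :: "field \<Rightarrow> real \<times> real \<Rightarrow> (real ^ 4) set" where
  "normal_space z p = {n. \<forall>t \<in> tangent_space z p. ip n t = 0}"

(* At a point of a Lorentz surface the ambient space is the direct sum of the tangent and
   the normal plane, so the vector described is unique. *)
definition normal_part :: "field \<Rightarrow> real \<times> real \<Rightarrow> real ^ 4 \<Rightarrow> real ^ 4" where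
  "normal_part z p w = (THE n. n \<in> normal_space z p \<and> w - n \<in> tangent_space z p)"

definition tangent_field :: "(real \<times> real) set \<Rightarrow> field \<Rightarrow> field \<Rightarrow> bool" where
  "tangent_field U z X \<longleftrightarrow> smooth_on U X \<and> (\<forall>p\<in>U. X p \<in> tangent_space z p)"

definition normal_field :: "(real \<times> real) set \<Rightarrow> field \<Rightarrow> field \<Rightarrow> bool" where
  "normal_field U z N \<longleftrightarrow> smooth_on U N \<and> (\<forall>p\<in>U. N p \<in> normal_space z p)"

(* The components of a tangent field with respect to z_u, z_v. *)
definition coords :: "field \<Rightarrow> field \<Rightarrow> real \<times> real \<Rightarrow> real \<times> real" where
  "coords z X p = (THE w. differential z p w = X p)"

(* The derivative of W along the tangent field X in the flat ambient connection. *)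
definition ambient_deriv :: "field \<Rightarrow> field \<Rightarrow> field \<Rightarrow> field" where
  "ambient_deriv z X W p = frechet_derivative W (at p) (coords z X p)"

(* The push-forward of the Lie bracket in the parameter plane. *)
definition lie_bracket :: "field \<Rightarrow> field \<Rightarrow> field \<Rightarrow> field" where
  "lie_bracket z X Y p = differential z p
     (frechet_derivative (coords z Y) (at p) (coords z X p)
      - frechet_derivative (coords z X) (at p) (coords z Y p))"

definition second_ff :: "field \<Rightarrow> field \<Rightarrow> field \<Rightarrow> field" where
  "second_ff z X Y p = normal_part z p (ambient_deriv z X Y p)"

definition normal_conn :: "field \<Rightarrow> field \<Rightarrow> field \<Rightarrow> field" where
  "normal_conn z X N p = normal_part z p (ambient_deriv z X N p)"

definition normal_curv_tensor :: "field \<Rightarrow> field \<Rightarrow> field \<Rightarrow> field \<Rightarrow> field" where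
  "normal_curv_tensor z X Y N p =
     normal_conn z X (normal_conn z Y N) p
     - normal_conn z Y (normal_conn z X N) p
     - normal_conn z (lie_bracket z X Y) N p"

definition gauss_curvature :: "field \<Rightarrow> field \<Rightarrow> field \<Rightarrow> real \<times> real \<Rightarrow> real" where
  "gauss_curvature z x y p =
     (ip (second_ff z x x p) (second_ff z y y p) - ip (second_ff z x y p) (second_ff z x y p))
     / (ip (x p) (x p) * ip (y p) (y p) - (ip (x p) (y p))\<^sup>2)"

definition normal_curvature ::
    "field \<Rightarrow> field \<Rightarrow> field \<Rightarrow> field \<Rightarrow> field \<Rightarrow> real \<times> real \<Rightarrow> real" where
  "normal_curvature z x y n1 n2 p =
     ip (normal_curv_tensor z x y n1 p) (n2 p)
     / (ip (x p) (x p) * ip (y p) (y p) - (ip (x p) (y p))\<^sup>2)"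

definition coeff_E :: "field \<Rightarrow> real \<times> real \<Rightarrow> real" where
  "coeff_E z p = ip (pd_u z p) (pd_u z p)"

definition coeff_F :: "field \<Rightarrow> real \<times> real \<Rightarrow> real" where
  "coeff_F z p = ip (pd_u z p) (pd_v z p)"

definition coeff_G :: "field \<Rightarrow> real \<times> real \<Rightarrow> real" where
  "coeff_G z p = ip (pd_v z p) (pd_v z p)"

(* Half the metric trace of the second fundamental form, taken in the basis z_u, z_v:
   the inverse of the Gram matrix (E, F; F, G) is (G, -F; -F, E) / (E G - F^2). *)
definition mean_curvature_vector :: "field \<Rightarrow> field" where
  "mean_curvature_vector z p =
     (1 / 2) *\<^sub>R ((1 / (coeff_E z p * coeff_G z p - (coeff_F z p)\<^sup>2)) *\<^sub>R
       (coeff_G z p *\<^sub>R second_ff z (pd_u z) (pd_u z) p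
        - (2 * coeff_F z p) *\<^sub>R second_ff z (pd_u z) (pd_v z) p
        + coeff_E z p *\<^sub>R second_ff z (pd_v z) (pd_v z) p))"

(* An immersed surface whose induced metric has signature (1,1): each tangent plane has an
   orthogonal basis a, b with ip a a = 1 and ip b b = -1. *)
definition lorentz_surface :: "(real \<times> real) set \<Rightarrow> field \<Rightarrow> bool" where
  "lorentz_surface U z \<longleftrightarrow> smooth_on U z \<and>
     (\<forall>p\<in>U. inj (differential z p) \<and>
        (\<exists>a \<in> tangent_space z p. \<exists>b \<in> tangent_space z p.
           ip a a = 1 \<and> ip b b = - 1 \<and> ip a b = 0))"

definition minimal_lorentz_surface :: "(real \<times> real) set \<Rightarrow> field \<Rightarrow> bool" where
  "minimal_lorentz_surface U z \<longleftrightarrow>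
     lorentz_surface U z \<and> (\<forall>p\<in>U. mean_curvature_vector z p = 0)"

definition first_normal_space :: "(real \<times> real) set \<Rightarrow> field \<Rightarrow> real \<times> real \<Rightarrow> (real ^ 4) set" where
  "first_normal_space U z p =
     span {second_ff z X Y p | X Y. tangent_field U z X \<and> tangent_field U z Y}"

definition orthonormal_frame ::
    "(real \<times> real) set \<Rightarrow> field \<Rightarrow> real \<Rightarrow> field \<Rightarrow> field \<Rightarrow> field \<Rightarrow> field \<Rightarrow> bool" where
  "orthonormal_frame U z \<epsilon> x y n1 n2 \<longleftrightarrow> \<epsilon> \<in> {1, - 1} \<and>
     tangent_field U z x \<and> tangent_field U z y \<and>
     normal_field U z n1 \<and> normal_field U z n2 \<and>
     (\<forall>p\<in>U. ip (x p) (x p) = 1 \<and> ip (y p) (y p) = - 1 \<and> ip (x p) (y p) = 0 \<and>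
            ip (n1 p) (n1 p) = \<epsilon> \<and> ip (n2 p) (n2 p) = - \<epsilon> \<and> ip (n1 p) (n2 p) = 0)"

(* K does not depend on the frame and the normal curvature depends on it only up to sign, so
   the sign of the difference of their squares may be tested in any local orthonormal frame. *)
definition general_type :: "(real \<times> real) set \<Rightarrow> field \<Rightarrow> bool" where
  "general_type U z \<longleftrightarrow> minimal_lorentz_surface U z \<and>
     (\<forall>p\<in>U. dim (first_normal_space U z p) = 2) \<and>
     (\<exists>V. open V \<and> V \<subseteq> U \<and> U \<subseteq> closure V \<and>
        (\<forall>p\<in>V. \<exists>W \<epsilon> x y n1 n2. open W \<and> p \<in> W \<and> W \<subseteq> U \<and>
           orthonormal_frame W z \<epsilon> x y n1 n2 \<and>
           (gauss_curvature z x y p)\<^sup>2 - (normal_curvature z x y n1 n2 p)\<^sup>2 > 0))"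

definition geometric_frame ::
    "(real \<times> real) set \<Rightarrow> field \<Rightarrow> real \<Rightarrow> field \<Rightarrow> field \<Rightarrow> field \<Rightarrow> field
      \<Rightarrow> (real \<times> real \<Rightarrow> real) \<Rightarrow> (real \<times> real \<Rightarrow> real) \<Rightarrow> bool" where
  "geometric_frame U z \<epsilon> x y n1 n2 \<mu> \<nu> \<longleftrightarrow> orthonormal_frame U z \<epsilon> x y n1 n2 \<and>
     (\<forall>p\<in>U. second_ff z x x p = \<nu> p *\<^sub>R n1 p \<and>
            second_ff z y y p = \<nu> p *\<^sub>R n1 p \<and>
            second_ff z x y p = \<mu> p *\<^sub>R n2 p \<and>
            \<mu> p * \<nu> p \<noteq> 0)"

definition canonical_parameters ::
    "(real \<times> real) set \<Rightarrow> field \<Rightarrow> field \<Rightarrow> field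
      \<Rightarrow> (real \<times> real \<Rightarrow> real) \<Rightarrow> (real \<times> real \<Rightarrow> real) \<Rightarrow> bool" where
  "canonical_parameters U z x y \<mu> \<nu> \<longleftrightarrow>
     (\<forall>p\<in>U. pd_u z p = sqrt (coeff_E z p) *\<^sub>R x p \<and>
            pd_v z p = sqrt (- coeff_G z p) *\<^sub>R y p \<and>
            coeff_E z p = 1 / sqrt \<bar>(\<mu> p)\<^sup>2 - (\<nu> p)\<^sup>2\<bar> \<and>
            coeff_F z p = 0 \<and>
            coeff_G z p = - (1 / sqrt \<bar>(\<mu> p)\<^sup>2 - (\<nu> p)\<^sup>2\<bar>))"

end

theory Submission
  imports Defs
begin

text \<open>Put \<open>e = sqrt E\<close>, so that \<open>z\<^sub>u = e x\<close>, \<open>z\<^sub>v = e y\<close>. The Gauss and Ricci equations give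
  \<open>K = -\<epsilon> (\<mu>\<^sup>2 + \<nu>\<^sup>2)\<close> and \<open>\<kappa> = -2 \<mu> \<nu>\<close>. The canonical normalization \<open>e\<^sup>4 \<bar>\<mu>\<^sup>2 - \<nu>\<^sup>2\<bar> = 1\<close>
  turns \<open>ln (K\<^sup>2 - \<kappa>\<^sup>2)\<close> into \<open>-8 ln e\<close>, and the Gauss equation is a formula for the hyperbolic Laplacian
  of \<open>ln e\<close>. It also turns \<open>(K + \<epsilon> \<kappa>) / (K - \<epsilon> \<kappa>)\<close> into the fourth power of \<open>S = e\<^sup>2 (\<mu> + \<nu>)\<close>; by the
  Codazzi equations the gradient of \<open>ln \<bar>S\<bar>\<close> is the normal connection form with its components swapped, so
  its hyperbolic Laplacian is the curvature of the normal connection, given by the Ricci equation.\<close>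

section \<open>Partial derivatives\<close>

text \<open>Total differentiability together with both partial derivatives. The values of
  \<open>pd_u\<close> and \<open>pd_v\<close> alone say nothing about existence, and the chain and
  product rules need the total derivative.\<close>

definition has_pd :: "(real \<times> real \<Rightarrow> 'a::real_normed_vector) \<Rightarrow> real \<times> real \<Rightarrow> 'a \<Rightarrow> 'a \<Rightarrow> bool" where
  "has_pd f p a b \<longleftrightarrow> (f has_derivative (\<lambda>w. fst w *\<^sub>R a + snd w *\<^sub>R b)) (at p)"

lemma has_pd_imp_u:
  assumes "has_pd f p a b"
  shows "((\<lambda>s. f (s, snd p)) has_vector_derivative a) (at (fst p))"
proof -
  have "((\<lambda>s. (s, snd p)) has_derivative (\<lambda>h. (h, 0))) (at (fst p))"
    by (intro has_derivative_Pair has_derivative_ident has_derivative_const)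
  moreover have "(f has_derivative (\<lambda>w. fst w *\<^sub>R a + snd w *\<^sub>R b)) (at (fst p, snd p))"
    using assms by (simp add: has_pd_def)
  ultimately show ?thesis
    using has_derivative_compose[of "\<lambda>s. (s, snd p)" _ "fst p" UNIV f]
    by (fastforce simp: has_vector_derivative_def)
qed

lemma has_pd_imp_v:
  assumes "has_pd f p a b"
  shows "((\<lambda>t. f (fst p, t)) has_vector_derivative b) (at (snd p))"
proof -
  have "((\<lambda>t. (fst p, t)) has_derivative (\<lambda>h. (0, h))) (at (snd p))"
    by (intro has_derivative_Pair has_derivative_ident has_derivative_const)
  moreover have "(f has_derivative (\<lambda>w. fst w *\<^sub>R a + snd w *\<^sub>R b)) (at (fst p, snd p))"
    using assms by (simp add: has_pd_def)
  ultimately show ?thesis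
    using has_derivative_compose[of "\<lambda>t. (fst p, t)" _ "snd p" UNIV f]
    by (fastforce simp: has_vector_derivative_def)
qed

lemma has_pd_pd_u: "has_pd f p a b \<Longrightarrow> pd_u f p = a"
  unfolding pd_u_def by (intro vector_derivative_at has_pd_imp_u)

lemma has_pd_pd_v: "has_pd f p a b \<Longrightarrow> pd_v f p = b"
  unfolding pd_v_def by (intro vector_derivative_at has_pd_imp_v)

lemma has_pd_unique:
  assumes "has_pd f p a b" "has_pd f p c d"
  shows "a = c" "b = d"
  using assms[THEN has_pd_pd_u] assms[THEN has_pd_pd_v] by simp_all

lemma has_pd_frechet_derivative:
  "has_pd f p a b \<Longrightarrow> frechet_derivative f (at p) w = fst w *\<^sub>R a + snd w *\<^sub>R b"
  unfolding has_pd_def by (drule frechet_derivative_at) (simp add: fun_eq_iff)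

lemma has_pd_differentiable: "has_pd f p a b \<Longrightarrow> f differentiable (at p)"
  unfolding has_pd_def differentiable_def by blast

text \<open>A linear map on the plane is determined by its values at \<open>(1, 0)\<close> and
  \<open>(0, 1)\<close>; restriction to the coordinate lines identifies these values with the
  partial derivatives.\<close>

lemma differentiable_has_pd:
  assumes "f differentiable (at p)"
  shows "has_pd f p (pd_u f p) (pd_v f p)"
proof -
  let ?D = "frechet_derivative f (at p)"
  have lin: "linear ?D"
    using assms by (rule linear_frechet_derivative)
  have "?D w = fst w *\<^sub>R ?D (1, 0) + snd w *\<^sub>R ?D (0, 1)" for w
  proof -
    have "w = fst w *\<^sub>R (1, 0) + snd w *\<^sub>R (0, 1)"
      by (simp add: prod_eq_iff)
    then have "?D w = ?D (fst w *\<^sub>R (1, 0) + snd w *\<^sub>R (0, 1))"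
      by (rule arg_cong)
    then show ?thesis
      by (simp only: linear_add[OF lin] linear_scale[OF lin])
  qed
  then have "?D = (\<lambda>w. fst w *\<^sub>R ?D (1, 0) + snd w *\<^sub>R ?D (0, 1))"
    by blast
  then have "has_pd f p (?D (1, 0)) (?D (0, 1))"
    using assms[unfolded frechet_derivative_works] unfolding has_pd_def by simp
  then show ?thesis
    using has_pd_pd_u has_pd_pd_v by metis
qed

lemma has_pd_transform:
  assumes "has_pd f p a b" "open U" "p \<in> U" "\<And>q. q \<in> U \<Longrightarrow> g q = f q"
  shows "has_pd g p a b"
  using has_derivative_transform_within_open[OF assms(1)[unfolded has_pd_def] assms(2,3)] assms(4)
  unfolding has_pd_def by simp

lemma has_pd_const: "has_pd (\<lambda>q. c) p 0 0"
  unfolding has_pd_def by simp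

lemma has_pd_add:
  assumes "has_pd f p a b" "has_pd g p c d"
  shows "has_pd (\<lambda>q. f q + g q) p (a + c) (b + d)"
  using has_derivative_add[OF assms[unfolded has_pd_def]]
  unfolding has_pd_def by (simp add: algebra_simps)

lemma has_pd_bilinear:
  assumes "bounded_bilinear B" "has_pd f p a b" "has_pd g p c d"
  shows "has_pd (\<lambda>q. B (f q) (g q)) p (B (f p) c + B a (g p)) (B (f p) d + B b (g p))"
proof -
  interpret bounded_bilinear B by fact
  show ?thesis
    using FDERIV[OF assms(2,3)[unfolded has_pd_def]]
    unfolding has_pd_def by (simp add: add_left add_right scaleR_left scaleR_right algebra_simps)
qed

lemma has_pd_linear:
  assumes "bounded_linear L" "has_pd f p a b"
  shows "has_pd (\<lambda>q. L (f q)) p (L a) (L b)"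
proof -
  interpret bounded_linear L by fact
  show ?thesis
    using has_derivative[OF assms(2)[unfolded has_pd_def]]
    unfolding has_pd_def by (simp add: add scale)
qed

lemmas has_pd_scaleR = has_pd_bilinear[OF bounded_bilinear_scaleR]
lemmas has_pd_mult = has_pd_bilinear[OF bounded_bilinear_mult]

lemma has_pd_cmult: "has_pd f p a b \<Longrightarrow> has_pd (\<lambda>q. c * f q) p (c * a) (c * b)"
  for f :: "real \<times> real \<Rightarrow> real"
  using has_pd_linear[OF bounded_linear_mult_right] .

lemma has_pd_chain:
  assumes "has_pd f p a b" "(\<phi> has_real_derivative d) (at (f p))"
  shows "has_pd (\<lambda>q. \<phi> (f q)) p (d * a) (d * b)"
proof -
  have "((\<lambda>q. \<phi> (f q)) has_derivative (\<lambda>w. d * (fst w *\<^sub>R a + snd w *\<^sub>R b))) (at p)"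
    using has_derivative_compose[OF assms(1)[unfolded has_pd_def]
        assms(2)[unfolded has_field_derivative_def]] .
  then show ?thesis
    unfolding has_pd_def by (simp add: algebra_simps)
qed

text \<open>Second derivatives at \<open>p\<close> require the gradient on a whole neighbourhood, so
  \<open>a\<close> and \<open>b\<close> are given on \<open>U\<close>, whereas their own derivatives
  are needed only at \<open>p\<close>.\<close>

lemma hyp_laplacian_eq:
  assumes "open U" "p \<in> U" "\<And>q. q \<in> U \<Longrightarrow> has_pd f q (a q) (b q)"
    and "has_pd a p a1 a2" "has_pd b p b1 b2"
  shows "hyp_laplacian f p = a1 - b2"
proof -
  have "pd_u f q = a q" "pd_v f q = b q" if "q \<in> U" for q
    using assms(3)[OF that] has_pd_pd_u has_pd_pd_v by blast+
  then have "has_pd (pd_u f) p a1 a2" "has_pd (pd_v f) p b1 b2"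
    using has_pd_transform[OF assms(4,1,2)] has_pd_transform[OF assms(5,1,2)] by blast+
  then show ?thesis
    unfolding hyp_laplacian_def using has_pd_pd_u has_pd_pd_v by metis
qed

lemma smooth_on_pd:
  assumes "smooth_on U f"
  shows "smooth_on U (pd_u f)" "smooth_on U (pd_v f)"
  using assms unfolding smooth_on_def by (metis Ck_on.simps(2))+

lemma smooth_on_continuous_on: "smooth_on U f \<Longrightarrow> continuous_on U f"
  unfolding smooth_on_def by (metis Ck_on.simps(1))

lemma smooth_on_has_pd:
  assumes "smooth_on U f" "open U" "p \<in> U"
  shows "has_pd f p (pd_u f p) (pd_v f p)"
proof -
  have "f differentiable_on U"
    using assms(1) unfolding smooth_on_def by (metis Ck_on.simps(2))
  then show ?thesis
    using assms(2,3) by (metis differentiable_has_pd differentiable_on_eq_differentiable_at)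
qed

subsection \<open>Symmetry of the second derivative\<close>

text \<open>The mean value theorem is applied twice: in \<open>s\<close> to the difference of
  \<open>f\<close> between the levels \<open>b + h\<close> and \<open>b\<close>, then in
  \<open>t\<close> to \<open>f' s\<close>.\<close>

lemma second_difference_mvt:
  fixes f f' f'' :: "real \<Rightarrow> real \<Rightarrow> real"
  assumes "h > 0"
    and f': "\<And>s t. s \<in> {a..a + h} \<Longrightarrow> t \<in> {b..b + h} \<Longrightarrow>
      ((\<lambda>s. f s t) has_real_derivative f' s t) (at s)"
    and f'': "\<And>s t. s \<in> {a..a + h} \<Longrightarrow> t \<in> {b..b + h} \<Longrightarrow>
      ((\<lambda>t. f' s t) has_real_derivative f'' s t) (at t)"
  shows "\<exists>s\<in>{a..a + h}. \<exists>t\<in>{b..b + h}.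
    f (a + h) (b + h) - f (a + h) b - f a (b + h) + f a b = h * h * f'' s t"
proof -
  let ?g = "\<lambda>s. f s (b + h) - f s b"
  have "\<exists>s>a. s < a + h \<and> ?g (a + h) - ?g a = (a + h - a) * (f' s (b + h) - f' s b)"
    using \<open>h > 0\<close> by (intro MVT2 DERIV_diff f') auto
  then obtain s where s: "a < s" "s < a + h" "?g (a + h) - ?g a = h * (f' s (b + h) - f' s b)"
    by auto
  have "\<exists>t>b. t < b + h \<and> f' s (b + h) - f' s b = (b + h - b) * f'' s t"
    using \<open>h > 0\<close> s by (intro MVT2 f'') auto
  then obtain t where "b < t" "t < b + h" "f' s (b + h) - f' s b = h * f'' s t"
    by auto
  with s show ?thesis
    by (intro bexI[of _ s] bexI[of _ t]) (auto simp: algebra_simps)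
qed

text \<open>Schwarz's theorem. One second difference over a small square, computed in both orders,
  makes the two mixed derivatives agree at two points near \<open>p\<close>. If they differed at
  \<open>p\<close>, continuity would keep each within half the gap of its value there, and they
  could not agree.\<close>

lemma pd_commute_real:
  fixes f :: "real \<times> real \<Rightarrow> real"
  assumes "smooth_on U f" "open U" "p \<in> U"
  shows "pd_u (pd_v f) p = pd_v (pd_u f) p"
proof (rule ccontr)
  assume neq: "pd_u (pd_v f) p \<noteq> pd_v (pd_u f) p"
  define \<delta> where "\<delta> = \<bar>pd_u (pd_v f) p - pd_v (pd_u f) p\<bar> / 2"
  have "\<delta> > 0"
    using neq by (simp add: \<delta>_def)
  note sm = smooth_on_pd[OF assms(1)]
  have "isCont (pd_u (pd_v f)) p" "isCont (pd_v (pd_u f)) p"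
    using smooth_on_continuous_on smooth_on_pd sm assms(2,3)
    by (metis continuous_on_eq_continuous_at)+
  then have "\<exists>d>0. \<forall>q. dist q p < d \<longrightarrow> dist (pd_u (pd_v f) q) (pd_u (pd_v f) p) < \<delta>"
    "\<exists>d>0. \<forall>q. dist q p < d \<longrightarrow> dist (pd_v (pd_u f) q) (pd_v (pd_u f) p) < \<delta>"
    using \<open>\<delta> > 0\<close> unfolding continuous_at_eps_delta by blast+
  then obtain d1 d2 where
    d1: "d1 > 0" "\<And>q. dist q p < d1 \<Longrightarrow> \<bar>pd_u (pd_v f) q - pd_u (pd_v f) p\<bar> < \<delta>" and
    d2: "d2 > 0" "\<And>q. dist q p < d2 \<Longrightarrow> \<bar>pd_v (pd_u f) q - pd_v (pd_u f) p\<bar> < \<delta>"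
    unfolding dist_real_def by metis
  obtain d3 where d3: "d3 > 0" "\<And>q. dist q p < d3 \<Longrightarrow> q \<in> U"
    using assms(2,3) unfolding open_dist by blast
  \<comment> \<open>Points of the square of side \<open>h\<close> lie within \<open>2 * h\<close> of
    its corner \<open>p\<close>, which is below all three radii.\<close>
  define h where "h = min d1 (min d2 d3) / 3"
  have "h > 0"
    using d1 d2 d3 by (simp add: h_def)
  obtain a b where p: "p = (a, b)"
    by fastforce
  have near: "dist (s, t) p < d1 \<and> dist (s, t) p < d2 \<and> (s, t) \<in> U"
    if "s \<in> {a..a + h}" "t \<in> {b..b + h}" for s t
  proof -
    have "dist (s, t) p \<le> \<bar>s - a\<bar> + \<bar>t - b\<bar>"
      unfolding p dist_Pair_Pair dist_real_def power2_abs by (rule sqrt_sum_squares_le_sum_abs)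
    also have "\<dots> \<le> 2 * h"
      using that by auto
    also have "\<dots> < min d1 (min d2 d3)"
      using \<open>h > 0\<close> unfolding h_def by linarith
    finally show ?thesis
      using d3 by auto
  qed
  have pdu: "((\<lambda>s. g (s, t)) has_real_derivative pd_u g (s, t)) (at s)"
    and pdv: "((\<lambda>t. g (s, t)) has_real_derivative pd_v g (s, t)) (at t)"
    if "smooth_on U g" "s \<in> {a..a + h}" "t \<in> {b..b + h}" for g s t
    using has_pd_imp_u[OF smooth_on_has_pd[OF that(1) assms(2), of "(s, t)"]]
      has_pd_imp_v[OF smooth_on_has_pd[OF that(1) assms(2), of "(s, t)"]] near[OF that(2,3)]
    by (simp_all add: has_real_derivative_iff_has_vector_derivative)
  obtain s t where st: "s \<in> {a..a + h}" "t \<in> {b..b + h}"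
    "f (a + h, b + h) - f (a + h, b) - f (a, b + h) + f (a, b) = h * h * pd_v (pd_u f) (s, t)"
    using second_difference_mvt[OF \<open>h > 0\<close>, of a b "\<lambda>s t. f (s, t)" "\<lambda>s t. pd_u f (s, t)"
        "\<lambda>s t. pd_v (pd_u f) (s, t)"] pdu[OF assms(1)] pdv[OF sm(1)] by blast
  \<comment> \<open>The same second difference with the two variables exchanged, so that the other
    mixed derivative appears.\<close>
  obtain s' t' where st': "s' \<in> {a..a + h}" "t' \<in> {b..b + h}"
    "f (a + h, b + h) - f (a, b + h) - f (a + h, b) + f (a, b) = h * h * pd_u (pd_v f) (s', t')"
    using second_difference_mvt[OF \<open>h > 0\<close>, of b a "\<lambda>t s. f (s, t)" "\<lambda>t s. pd_v f (s, t)"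
        "\<lambda>t s. pd_u (pd_v f) (s, t)"] pdv[OF assms(1)] pdu[OF sm(2)] by blast
  have "h * h * pd_v (pd_u f) (s, t) = h * h * pd_u (pd_v f) (s', t')"
    using st(3) st'(3) by linarith
  then have "pd_v (pd_u f) (s, t) = pd_u (pd_v f) (s', t')"
    using \<open>h > 0\<close> by simp
  moreover have "\<bar>pd_u (pd_v f) (s', t') - pd_u (pd_v f) p\<bar> < \<delta>"
    "\<bar>pd_v (pd_u f) (s, t) - pd_v (pd_u f) p\<bar> < \<delta>"
    using d1 d2 near st st' by blast+
  ultimately show False
    unfolding \<delta>_def by (smt (verit) field_sum_of_halves)
qed

text \<open>Bounded linear maps commute with differentiation. Equality of \<open>g\<close> with
  \<open>L\<close> after \<open>f\<close> is asked only on \<open>U\<close>, because the induction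
  passes to \<open>pd_u g\<close> and \<open>pd_v g\<close>, which are known only there.\<close>

lemma Ck_on_linear:
  assumes "bounded_linear L" "open U" "Ck_on k U f"
    and "\<And>q. q \<in> U \<Longrightarrow> g q = L (f q)"
  shows "Ck_on k U g"
  using assms(3,4)
proof (induction k arbitrary: f g)
  case 0
  have "continuous_on U (\<lambda>q. L (f q))"
    using 0 assms(1) by (auto intro: bounded_linear.continuous_on)
  then show ?case
    using 0 by (metis Ck_on.simps(1) continuous_on_cong)
next
  case (Suc k)
  have pd: "has_pd g q (L (pd_u f q)) (L (pd_v f q))" if "q \<in> U" for q
  proof -
    have "f differentiable (at q)"
      using Suc.prems(1) that differentiable_on_eq_differentiable_at[OF assms(2), of f] by simp
    then show ?thesis
      using has_pd_transform[OF has_pd_linear[OF assms(1) differentiable_has_pd] assms(2) that]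
        Suc.prems(2) by blast
  qed
  have "Ck_on k U (pd_u g)" "Ck_on k U (pd_v g)"
    using Suc.IH[of "pd_u f" "pd_u g"] Suc.IH[of "pd_v f" "pd_v g"] Suc.prems
      has_pd_pd_u[OF pd] has_pd_pd_v[OF pd] by auto
  moreover have "g differentiable_on U"
    using has_pd_differentiable[OF pd] assms(2) differentiable_on_eq_differentiable_at by blast
  ultimately show ?case
    by simp
qed

text \<open>Reduction to the real case by taking the coordinate along each basis vector.\<close>

lemma pd_commute:
  fixes f :: "real \<times> real \<Rightarrow> 'a::euclidean_space"
  assumes "smooth_on U f" "open U" "p \<in> U"
  shows "pd_u (pd_v f) p = pd_v (pd_u f) p"
proof (rule euclidean_eqI)
  fix i :: 'a
  let ?L = "\<lambda>w. w \<bullet> i"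
  have L: "bounded_linear ?L"
    by (rule bounded_linear_inner_left)
  have comp: "pd_u (\<lambda>q. ?L (g q)) q = ?L (pd_u g q) \<and> pd_v (\<lambda>q. ?L (g q)) q = ?L (pd_v g q)"
    if "smooth_on U g" "q \<in> U" for g :: "real \<times> real \<Rightarrow> 'a" and q
    using has_pd_linear[OF L smooth_on_has_pd[OF that(1) assms(2) that(2)]]
      has_pd_pd_u has_pd_pd_v by blast
  have smL: "smooth_on U (\<lambda>q. ?L (f q))"
    using assms(1) unfolding smooth_on_def by (blast intro: Ck_on_linear[OF L assms(2) _ refl])
  note sm = smooth_on_pd[OF assms(1)]
  have "has_pd (pd_v (\<lambda>q. ?L (f q))) p (?L (pd_u (pd_v f) p)) (?L (pd_v (pd_v f) p))"
    by (rule has_pd_transform[OF has_pd_linear[OF L smooth_on_has_pd[OF sm(2) assms(2,3)]] assms(2,3)])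
      (simp add: comp[OF assms(1)])
  moreover have "has_pd (pd_u (\<lambda>q. ?L (f q))) p (?L (pd_u (pd_u f) p)) (?L (pd_v (pd_u f) p))"
    by (rule has_pd_transform[OF has_pd_linear[OF L smooth_on_has_pd[OF sm(1) assms(2,3)]] assms(2,3)])
      (simp add: comp[OF assms(1)])
  ultimately show "pd_u (pd_v f) p \<bullet> i = pd_v (pd_u f) p \<bullet> i"
    using pd_commute_real[OF smL assms(2,3)] has_pd_pd_u has_pd_pd_v by metis
qed

section \<open>The inner product\<close>

lemma ip_commute: "ip a b = ip b a"
  unfolding ip_def by (simp add: mult.commute)

lemma bounded_bilinear_ip: "bounded_bilinear ip"
  unfolding bilinear_conv_bounded_bilinear[symmetric] bilinear_def linear_iff ip_def
  by (simp add: algebra_simps)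

interpretation ip: bounded_bilinear ip
  by (rule bounded_bilinear_ip)

lemmas ip_simps =
  ip.add_left ip.add_right ip.diff_left ip.diff_right ip.minus_left ip.minus_right
  ip.scaleR_left ip.scaleR_right ip.zero_left ip.zero_right

text \<open>Pairing a vanishing combination with each vector gives independence, and four
  independent vectors span the space. The coefficients are then read off by pairing; the signs are
  those of the squares, and \<open>\<epsilon>\<close> is its own inverse.\<close>

lemma orthonormal_expansion:
  assumes "\<epsilon> \<in> {1, - 1}"
    and "ip x x = 1" "ip y y = - 1" "ip n1 n1 = \<epsilon>" "ip n2 n2 = - \<epsilon>"
    and "ip x y = 0" "ip n1 x = 0" "ip n1 y = 0" "ip n2 x = 0" "ip n2 y = 0" "ip n1 n2 = 0"
  shows "w = ip w x *\<^sub>R x - ip w y *\<^sub>R y + (\<epsilon> * ip w n1) *\<^sub>R n1 - (\<epsilon> * ip w n2) *\<^sub>R n2"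
proof -
  let ?B = "{x, y, n1, n2}"
  have \<epsilon>: "\<epsilon> \<noteq> 0"
    using assms(1) by auto
  have sym: "ip y x = 0" "ip x n1 = 0" "ip y n1 = 0" "ip x n2 = 0" "ip y n2 = 0" "ip n2 n1 = 0"
    using assms(6-11) ip_commute by metis+
  have dist: "x \<noteq> y" "x \<noteq> n1" "x \<noteq> n2" "y \<noteq> n1" "y \<noteq> n2" "n1 \<noteq> n2"
    using assms(2-11) sym \<epsilon> by auto
  have "independent ?B"
  proof (rule independent_if_scalars_zero)
    fix f v assume "(\<Sum>v\<in>?B. f v *\<^sub>R v) = 0" and v: "v \<in> ?B"
    then have sum0: "f x *\<^sub>R x + f y *\<^sub>R y + f n1 *\<^sub>R n1 + f n2 *\<^sub>R n2 = 0"
      using dist by (simp add: add.assoc)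
    have "ip (f x *\<^sub>R x + f y *\<^sub>R y + f n1 *\<^sub>R n1 + f n2 *\<^sub>R n2) t = 0" for t
      unfolding sum0 by (simp add: ip_simps)
    from this[of x] this[of y] this[of n1] this[of n2] v show "f v = 0"
      using assms(2-11) sym \<epsilon> by (auto simp: ip_simps)
  qed simp
  moreover have "card ?B = 4"
    using dist by simp
  ultimately have "span ?B = UNIV"
    using card_ge_dim_independent[of ?B UNIV] by auto
  then have "w \<in> span ?B"
    by simp
  then obtain a b c d where w: "w = a *\<^sub>R x + b *\<^sub>R y + c *\<^sub>R n1 + d *\<^sub>R n2"
    by (auto simp: span_breakdown_eq algebra_simps)
  have ips: "ip w x = a" "ip w y = - b" "ip w n1 = \<epsilon> * c" "ip w n2 = - (\<epsilon> * d)"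
    unfolding w using assms(2-11) sym by (simp_all add: ip_simps)
  have \<epsilon>\<epsilon>: "\<epsilon> * (\<epsilon> * c) = c" "\<epsilon> * - (\<epsilon> * d) = - d"
    using assms(1) by auto
  show ?thesis
    unfolding ips \<epsilon>\<epsilon> by (simp add: w)
qed

lemma has_pd_ip:
  assumes "has_pd f p a b" "has_pd g p c d"
  shows "has_pd (\<lambda>q. ip (f q) (g q)) p (ip a (g p) + ip (f p) c) (ip b (g p) + ip (f p) d)"
  using has_pd_bilinear[OF bounded_bilinear_ip assms] by (simp add: add.commute)

text \<open>Since the mixed derivatives of \<open>a\<close> cancel, this single identity yields each of the
  Gauss, Codazzi and Ricci equations.\<close>

lemma pd_ip_integrability:
  assumes "smooth_on U a" "smooth_on U b" "open U" "p \<in> U"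
    and "\<And>q. q \<in> U \<Longrightarrow> ip (pd_u a q) (b q) = f q" "has_pd f p fu fv"
    and "\<And>q. q \<in> U \<Longrightarrow> ip (pd_v a q) (b q) = g q" "has_pd g p gu gv"
  shows "fv - gu = ip (pd_u a p) (pd_v b p) - ip (pd_v a p) (pd_u b p)"
proof -
  note b = smooth_on_has_pd[OF assms(2-4)]
  note au = smooth_on_has_pd[OF smooth_on_pd(1)[OF assms(1)] assms(3,4)]
  note av = smooth_on_has_pd[OF smooth_on_pd(2)[OF assms(1)] assms(3,4)]
  have "has_pd (\<lambda>q. ip (pd_u a q) (b q)) p fu fv" "has_pd (\<lambda>q. ip (pd_v a q) (b q)) p gu gv"
    by (rule has_pd_transform[OF assms(6,3,4)] has_pd_transform[OF assms(8,3,4)], simp add: assms(5,7))+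
  from has_pd_unique[OF this(1) has_pd_ip[OF au b]] has_pd_unique[OF this(2) has_pd_ip[OF av b]]
  show ?thesis
    using pd_commute[OF assms(1,3,4)] by simp
qed

text \<open>The product rule for a constant. For members of an orthonormal frame this is the
  skew-symmetry of the connection coefficients.\<close>

lemma pd_ip_const:
  assumes "smooth_on U a" "smooth_on U b" "open U" "p \<in> U" "\<And>q. q \<in> U \<Longrightarrow> ip (a q) (b q) = c"
  shows "ip (pd_u a p) (b p) = - ip (a p) (pd_u b p)" "ip (pd_v a p) (b p) = - ip (a p) (pd_v b p)"
proof -
  note pd = has_pd_ip[OF smooth_on_has_pd[OF assms(1,3,4)] smooth_on_has_pd[OF assms(2-4)]]
  have "has_pd (\<lambda>q. ip (a q) (b q)) p 0 0"
    by (rule has_pd_transform[OF has_pd_const assms(3,4)]) (rule assms(5))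
  from has_pd_unique[OF this pd]
  show "ip (pd_u a p) (b p) = - ip (a p) (pd_u b p)" "ip (pd_v a p) (b p) = - ip (a p) (pd_v b p)"
    by linarith+
qed

section \<open>The structure equations in canonical parameters\<close>

locale canonical_surface =
  fixes U :: "(real \<times> real) set"
    and z x y n1 n2 :: field
    and \<epsilon> :: real
    and \<mu> \<nu> :: "real \<times> real \<Rightarrow> real"
  assumes open_U: "open U"
    and lorentz: "lorentz_surface U z"
    and geometric: "geometric_frame U z \<epsilon> x y n1 n2 \<mu> \<nu>"
    and canonical: "canonical_parameters U z x y \<mu> \<nu>"
begin

definition e :: "real \<times> real \<Rightarrow> real" where
  "e q = sqrt (coeff_E z q)"

lemma smooth: "smooth_on U z" "smooth_on U x" "smooth_on U y" "smooth_on U n1" "smooth_on U n2"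
  using lorentz geometric
  unfolding lorentz_surface_def geometric_frame_def orthonormal_frame_def
    tangent_field_def normal_field_def by - (elim conjE, assumption)+

lemma \<epsilon>: "\<epsilon> \<in> {1, - 1}"
  using geometric unfolding geometric_frame_def orthonormal_frame_def by (elim conjE)

lemma \<epsilon>_square: "\<epsilon> * \<epsilon> = 1" "\<epsilon> * (\<epsilon> * t) = t"
  using \<epsilon> by auto

lemmas has_pd = smooth_on_has_pd[OF _ open_U]

lemma differential_z: "p \<in> U \<Longrightarrow> differential z p w = fst w *\<^sub>R pd_u z p + snd w *\<^sub>R pd_v z p"
  using has_pd_frechet_derivative[OF has_pd[OF smooth(1)]] .

lemma z_uv:
  assumes "p \<in> U"
  shows "pd_u z p = e p *\<^sub>R x p" "pd_v z p = e p *\<^sub>R y p"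
proof -
  have c: "pd_u z p = sqrt (coeff_E z p) *\<^sub>R x p" "pd_v z p = sqrt (- coeff_G z p) *\<^sub>R y p"
    "coeff_E z p = 1 / sqrt \<bar>(\<mu> p)\<^sup>2 - (\<nu> p)\<^sup>2\<bar>"
    "coeff_G z p = - (1 / sqrt \<bar>(\<mu> p)\<^sup>2 - (\<nu> p)\<^sup>2\<bar>)"
    using bspec[OF canonical[unfolded canonical_parameters_def] assms] by - (elim conjE, assumption)+
  have "- coeff_G z p = coeff_E z p"
    unfolding c(3,4) by simp
  then show "pd_u z p = e p *\<^sub>R x p" "pd_v z p = e p *\<^sub>R y p"
    unfolding e_def using c(1,2) by simp_all
qed

text \<open>Since \<open>1 / 0 = 0\<close>, the formula for \<open>coeff_E\<close> only gives a
  nonnegative value; injectivity of the differential excludes zero.\<close>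

lemma e_pos:
  assumes "p \<in> U"
  shows "e p > 0"
proof -
  have "inj (differential z p)"
    using lorentz assms unfolding lorentz_surface_def by blast
  then have "differential z p (1, 0) \<noteq> differential z p (0, 0)"
    by (simp add: inj_eq)
  then have "pd_u z p \<noteq> 0"
    by (simp add: differential_z assms)
  then have "e p \<noteq> 0"
    by (auto simp: z_uv assms)
  moreover have "coeff_E z p \<ge> 0"
    using canonical assms unfolding canonical_parameters_def by simp
  ultimately show ?thesis
    by (simp add: e_def)
qed

lemma e_power4:
  assumes "p \<in> U"
  shows "e p ^ 4 * \<bar>(\<mu> p)\<^sup>2 - (\<nu> p)\<^sup>2\<bar> = 1"
proof -
  let ?D = "\<bar>(\<mu> p)\<^sup>2 - (\<nu> p)\<^sup>2\<bar>"
  have E: "coeff_E z p = 1 / sqrt ?D"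
    using canonical assms unfolding canonical_parameters_def by simp
  \<comment> \<open>A vanishing \<open>?D\<close> would make \<open>coeff_E\<close>, hence
    \<open>e p\<close>, zero by the convention on division.\<close>
  then have "?D \<noteq> 0"
    using e_pos[OF assms] unfolding e_def by (metis div_by_0 less_irrefl real_sqrt_zero)
  have "(e p)\<^sup>2 = 1 / sqrt ?D"
    unfolding e_def E by simp
  then have "((e p)\<^sup>2)\<^sup>2 = 1 / ?D"
    by (simp add: power_divide)
  moreover have "((e p)\<^sup>2)\<^sup>2 = e p ^ 4"
    by (simp flip: power_mult)
  ultimately show ?thesis
    using \<open>?D \<noteq> 0\<close> by simp
qed

section \<open>Tangent and normal components with respect to the frame\<close>

lemma tangent_space_iff:
  assumes "p \<in> U"
  shows "t \<in> tangent_space z p \<longleftrightarrow> (\<exists>a b. t = a *\<^sub>R x p + b *\<^sub>R y p)"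
proof
  assume "t \<in> tangent_space z p"
  then show "\<exists>a b. t = a *\<^sub>R x p + b *\<^sub>R y p"
    unfolding tangent_space_def by (auto simp: differential_z z_uv assms)
next
  assume "\<exists>a b. t = a *\<^sub>R x p + b *\<^sub>R y p"
  then obtain a b where "t = a *\<^sub>R x p + b *\<^sub>R y p"
    by blast
  then have "t = differential z p (a / e p, b / e p)"
    using e_pos[OF assms] by (simp add: differential_z z_uv assms)
  then show "t \<in> tangent_space z p"
    unfolding tangent_space_def by blast
qed

lemma gram:
  assumes "p \<in> U"
  shows "ip (x p) (x p) = 1" "ip (y p) (y p) = - 1" "ip (n1 p) (n1 p) = \<epsilon>" "ip (n2 p) (n2 p) = - \<epsilon>"
    "ip (x p) (y p) = 0" "ip (n1 p) (n2 p) = 0"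
    "ip (n1 p) (x p) = 0" "ip (n1 p) (y p) = 0" "ip (n2 p) (x p) = 0" "ip (n2 p) (y p) = 0"
proof -
  have "x p \<in> tangent_space z p" "y p \<in> tangent_space z p"
    "n1 p \<in> normal_space z p" "n2 p \<in> normal_space z p"
    using geometric assms
    unfolding geometric_frame_def orthonormal_frame_def tangent_field_def normal_field_def by blast+
  then show "ip (n1 p) (x p) = 0" "ip (n1 p) (y p) = 0" "ip (n2 p) (x p) = 0" "ip (n2 p) (y p) = 0"
    unfolding normal_space_def by blast+
qed (use geometric assms in \<open>auto simp: geometric_frame_def orthonormal_frame_def\<close>)

lemma gram_swap:
  assumes "p \<in> U"
  shows "ip (y p) (x p) = 0" "ip (n2 p) (n1 p) = 0"
    "ip (x p) (n1 p) = 0" "ip (y p) (n1 p) = 0" "ip (x p) (n2 p) = 0" "ip (y p) (n2 p) = 0"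
  using gram(5-10)[OF assms] ip_commute by metis+

lemma expansion:
  assumes "p \<in> U"
  shows "w = ip w (x p) *\<^sub>R x p - ip w (y p) *\<^sub>R y p
    + (\<epsilon> * ip w (n1 p)) *\<^sub>R n1 p - (\<epsilon> * ip w (n2 p)) *\<^sub>R n2 p"
  using orthonormal_expansion[OF \<epsilon> gram(1-5,7-10,6)[OF assms]] .

text \<open>Evaluates products of frame derivatives from their components in the integrability
  identities below.\<close>

lemma ip_expansion:
  assumes "p \<in> U"
  shows "ip v w = ip v (x p) * ip w (x p) - ip v (y p) * ip w (y p)
    + \<epsilon> * (ip v (n1 p) * ip w (n1 p)) - \<epsilon> * (ip v (n2 p) * ip w (n2 p))"
  by (subst expansion[OF assms, of w]) (simp add: ip_simps algebra_simps)

text \<open>The last two terms of the frame expansion qualify. Two candidates differ by a vector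
  that is both tangent and normal, and the tangent plane is nondegenerate, so the description is
  unique.\<close>

lemma normal_part_eq:
  assumes "p \<in> U"
  shows "normal_part z p w = (\<epsilon> * ip w (n1 p)) *\<^sub>R n1 p - (\<epsilon> * ip w (n2 p)) *\<^sub>R n2 p" (is "_ = ?n")
  unfolding normal_part_def
proof (rule the_equality)
  have normal: "?n \<in> normal_space z p"
    unfolding normal_space_def by (auto simp: tangent_space_iff assms ip_simps gram)
  have "w - ?n = ip w (x p) *\<^sub>R x p + (- ip w (y p)) *\<^sub>R y p"
    by (subst expansion[OF assms, of w]) simp
  then have tangent: "w - ?n \<in> tangent_space z p"
    unfolding tangent_space_iff[OF assms] by blast
  show "?n \<in> normal_space z p \<and> w - ?n \<in> tangent_space z p"
    using normal tangent ..
  fix m assume m: "m \<in> normal_space z p \<and> w - m \<in> tangent_space z p"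
  obtain a b c d where "w - ?n = a *\<^sub>R x p + b *\<^sub>R y p" "w - m = c *\<^sub>R x p + d *\<^sub>R y p"
    using tangent m unfolding tangent_space_iff[OF assms] by blast
  then have diff: "m - ?n = (a - c) *\<^sub>R x p + (b - d) *\<^sub>R y p"
    by (simp add: algebra_simps)
  have "x p \<in> tangent_space z p" "y p \<in> tangent_space z p"
    unfolding tangent_space_iff[OF assms]
    by (intro exI[of _ 1] exI[of _ 0], simp) (intro exI[of _ 0] exI[of _ 1], simp)
  then have "ip (m - ?n) (x p) = 0" "ip (m - ?n) (y p) = 0"
    using m normal unfolding normal_space_def by (simp_all add: ip.diff_left)
  then have "a - c = 0" "b - d = 0"
    unfolding diff by (simp_all add: ip_simps gram gram_swap assms)
  with diff show "m = ?n"
    by simp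
qed

lemma ip_normal_part:
  assumes "p \<in> U"
  shows "ip (normal_part z p w) (n1 p) = ip w (n1 p)" "ip (normal_part z p w) (n2 p) = ip w (n2 p)"
  by (simp_all add: normal_part_eq ip_simps gram gram_swap \<epsilon>_square assms)

lemma coords_eq:
  assumes "p \<in> U" "X p = differential z p w"
  shows "coords z X p = w"
proof -
  have "inj (differential z p)"
    using lorentz assms unfolding lorentz_surface_def by blast
  then show ?thesis
    unfolding coords_def assms(2) by (auto simp: inj_eq)
qed

lemma coords_frame:
  assumes "p \<in> U"
  shows "coords z x p = (1 / e p, 0)" "coords z y p = (0, 1 / e p)"
  using e_pos[OF assms] by (auto intro!: coords_eq simp: differential_z z_uv assms)

lemma ambient_deriv_frame:
  assumes "p \<in> U" "has_pd W p a b"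
  shows "ambient_deriv z x W p = (1 / e p) *\<^sub>R a" "ambient_deriv z y W p = (1 / e p) *\<^sub>R b"
  unfolding ambient_deriv_def coords_frame[OF assms(1)]
  by (simp_all add: has_pd_frechet_derivative[OF assms(2)])

section \<open>Second fundamental form and connection coefficients\<close>

lemma second_ff_frame:
  assumes "p \<in> U"
  shows "second_ff z x x p = \<nu> p *\<^sub>R n1 p" "second_ff z y y p = \<nu> p *\<^sub>R n1 p"
    "second_ff z x y p = \<mu> p *\<^sub>R n2 p"
  using bspec[OF conjunct2[OF geometric[unfolded geometric_frame_def]] assms]
  by - (elim conjE, assumption)+

text \<open>The tangent Gram determinant is \<open>-1\<close>, and the opposite squares of
  \<open>n1\<close> and \<open>n2\<close> make both terms of the numerator carry the same
  sign.\<close>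

lemma gauss_curvature_eq:
  assumes "p \<in> U"
  shows "gauss_curvature z x y p = - \<epsilon> * ((\<mu> p)\<^sup>2 + (\<nu> p)\<^sup>2)"
  unfolding gauss_curvature_def second_ff_frame[OF assms]
  by (simp add: ip_simps gram assms power2_eq_square algebra_simps)

text \<open>\<open>\<alpha>\<close> and \<open>\<beta>\<close> turn out to be the derivatives of \<open>ln e\<close>; \<open>b_u\<close> and \<open>b_v\<close> are the components of the
  normal connection form \<open>b\<close>, where \<open>D n\<^sub>1 = b n\<^sub>2\<close> and \<open>D n\<^sub>2 = b n\<^sub>1\<close>.\<close>

definition \<alpha> :: "real \<times> real \<Rightarrow> real" where
  "\<alpha> q = ip (pd_v y q) (x q)"

definition \<beta> :: "real \<times> real \<Rightarrow> real" where
  "\<beta> q = ip (pd_u y q) (x q)"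

text \<open>\<open>M\<close> and \<open>N\<close> are the normal coefficients of the parameter
  derivatives of \<open>x\<close> and \<open>y\<close>; the factor \<open>e\<close> converts
  differentiation along the unit fields into differentiation in \<open>u\<close> and
  \<open>v\<close>.\<close>

definition M :: "real \<times> real \<Rightarrow> real" where
  "M q = e q * \<mu> q"

definition N :: "real \<times> real \<Rightarrow> real" where
  "N q = e q * \<nu> q"

definition b_u :: "real \<times> real \<Rightarrow> real" where
  "b_u q = - \<epsilon> * ip (pd_u n1 q) (n2 q)"

definition b_v :: "real \<times> real \<Rightarrow> real" where
  "b_v q = - \<epsilon> * ip (pd_v n1 q) (n2 q)"

text \<open>These components come directly from the geometric frame. Those of \<open>pd_v x\<close>
  belong to \<open>second_ff z y x\<close>, which the frame does not prescribe; they follow later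
  from symmetry of the mixed derivatives of \<open>z\<close>.\<close>

lemma ip_second_ff:
  assumes "p \<in> U"
  shows "ip (pd_u x p) (n1 p) = \<epsilon> * N p" "ip (pd_u x p) (n2 p) = 0"
    "ip (pd_v y p) (n1 p) = \<epsilon> * N p" "ip (pd_v y p) (n2 p) = 0"
    "ip (pd_u y p) (n1 p) = 0" "ip (pd_u y p) (n2 p) = - \<epsilon> * M p"
proof -
  note deriv = ambient_deriv_frame[OF assms has_pd[OF smooth(2) assms]]
    ambient_deriv_frame[OF assms has_pd[OF smooth(3) assms]]
  have *: "normal_part z p ((1 / e p) *\<^sub>R pd_u x p) = \<nu> p *\<^sub>R n1 p"
    "normal_part z p ((1 / e p) *\<^sub>R pd_v y p) = \<nu> p *\<^sub>R n1 p"
    "normal_part z p ((1 / e p) *\<^sub>R pd_u y p) = \<mu> p *\<^sub>R n2 p"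
    using second_ff_frame[OF assms] unfolding second_ff_def deriv by auto
  show "ip (pd_u x p) (n1 p) = \<epsilon> * N p" "ip (pd_u x p) (n2 p) = 0"
    "ip (pd_v y p) (n1 p) = \<epsilon> * N p" "ip (pd_v y p) (n2 p) = 0"
    "ip (pd_u y p) (n1 p) = 0" "ip (pd_u y p) (n2 p) = - \<epsilon> * M p"
    using *[THEN arg_cong, of "\<lambda>w. ip w (n1 p)"] *[THEN arg_cong, of "\<lambda>w. ip w (n2 p)"] e_pos[OF assms]
    by (auto simp: ip_normal_part ip_simps gram gram_swap assms M_def N_def field_simps)
qed

text \<open>Pairing \<open>pd_u z = e x\<close> with the unit field \<open>x\<close> exhibits
  \<open>e\<close> as an inner product of smooth fields, without differentiating the square
  root.\<close>

lemma e_differentiable: "p \<in> U \<Longrightarrow> has_pd e p (pd_u e p) (pd_v e p)"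
proof -
  assume p: "p \<in> U"
  have eq: "e q = ip (pd_u z q) (x q)" if "q \<in> U" for q
    using that by (simp add: z_uv ip_simps gram)
  show ?thesis
    by (rule differentiable_has_pd, rule has_pd_differentiable, rule has_pd_transform[OF _ open_U p eq],
        rule has_pd_ip[OF has_pd[OF smooth_on_pd(1)[OF smooth(1)] p] has_pd[OF smooth(2) p]])
qed

text \<open>The derivatives of \<open>e\<close> and the normal part of \<open>x\<^sub>v\<close> come from comparing the components of
  \<open>z\<^sub>u\<^sub>v = e\<^sub>v x + e x\<^sub>v\<close> and \<open>z\<^sub>v\<^sub>u = e\<^sub>u y + e y\<^sub>u\<close>.\<close>

lemma mixed:
  assumes "p \<in> U"
  shows "has_pd e p (e p * \<alpha> p) (e p * \<beta> p)" "ip (pd_v x p) (y p) = - \<alpha> p"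
    "ip (pd_v x p) (n1 p) = 0" "ip (pd_v x p) (n2 p) = - \<epsilon> * M p"
proof -
  have zu: "has_pd (pd_u z) p (e p *\<^sub>R pd_u x p + pd_u e p *\<^sub>R x p) (e p *\<^sub>R pd_v x p + pd_v e p *\<^sub>R x p)"
    by (rule has_pd_transform[OF has_pd_scaleR[OF e_differentiable has_pd[OF smooth(2)]] open_U])
      (simp_all add: assms z_uv)
  have zv: "has_pd (pd_v z) p (e p *\<^sub>R pd_u y p + pd_u e p *\<^sub>R y p) (e p *\<^sub>R pd_v y p + pd_v e p *\<^sub>R y p)"
    by (rule has_pd_transform[OF has_pd_scaleR[OF e_differentiable has_pd[OF smooth(3)]] open_U])
      (simp_all add: assms z_uv)
  have eq: "e p *\<^sub>R pd_u y p + pd_u e p *\<^sub>R y p = e p *\<^sub>R pd_v x p + pd_v e p *\<^sub>R x p"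
    using pd_commute[OF smooth(1) open_U assms] has_pd_pd_v[OF zu] has_pd_pd_u[OF zv] by simp
  have zero: "ip (pd_v x p) (x p) = 0" "ip (pd_u y p) (y p) = 0" "ip (pd_v y p) (y p) = 0"
    using pd_ip_const[OF smooth(2,2) open_U assms gram(1)] pd_ip_const[OF smooth(3,3) open_U assms gram(2)]
      ip_commute[of "x p"] ip_commute[of "y p"] by simp_all
  have *: "ip (pd_v x p) (y p) = - \<alpha> p"
    using pd_ip_const(2)[OF smooth(2,3) open_U assms gram(5)] unfolding \<alpha>_def by (simp add: ip_commute)
  then show "ip (pd_v x p) (y p) = - \<alpha> p" .
  have "pd_v e p = e p * \<beta> p"
    using eq[THEN arg_cong, of "\<lambda>w. ip w (x p)"] zero
    by (simp add: ip_simps gram gram_swap assms \<beta>_def)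
  moreover have "pd_u e p = e p * \<alpha> p"
    using eq[THEN arg_cong, of "\<lambda>w. ip w (y p)"] zero *
    by (simp add: ip_simps gram gram_swap assms)
  ultimately show "has_pd e p (e p * \<alpha> p) (e p * \<beta> p)"
    using e_differentiable[OF assms] by simp
  show "ip (pd_v x p) (n1 p) = 0"
    using eq[THEN arg_cong, of "\<lambda>w. ip w (n1 p)"] e_pos[OF assms]
    by (simp add: ip_simps gram gram_swap ip_second_ff assms)
  have "e p * ip (pd_v x p) (n2 p) = e p * (- \<epsilon> * M p)"
    using eq[THEN arg_cong, of "\<lambda>w. ip w (n2 p)"]
    by (simp add: ip_simps gram gram_swap ip_second_ff assms)
  then show "ip (pd_v x p) (n2 p) = - \<epsilon> * M p"
    using e_pos[OF assms] by (metis less_irrefl mult_left_cancel)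
qed

text \<open>The full table of structure equations: the components already known determine the
  remaining ones by skew-symmetry.\<close>

lemma frame_derivs:
  assumes "p \<in> U"
  shows
    "ip (pd_u x p) (x p) = 0" "ip (pd_u x p) (y p) = - \<beta> p"
    "ip (pd_u x p) (n1 p) = \<epsilon> * N p" "ip (pd_u x p) (n2 p) = 0"
    "ip (pd_v x p) (x p) = 0" "ip (pd_v x p) (y p) = - \<alpha> p"
    "ip (pd_v x p) (n1 p) = 0" "ip (pd_v x p) (n2 p) = - \<epsilon> * M p"
    "ip (pd_u y p) (x p) = \<beta> p" "ip (pd_u y p) (y p) = 0"
    "ip (pd_u y p) (n1 p) = 0" "ip (pd_u y p) (n2 p) = - \<epsilon> * M p"
    "ip (pd_v y p) (x p) = \<alpha> p" "ip (pd_v y p) (y p) = 0"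
    "ip (pd_v y p) (n1 p) = \<epsilon> * N p" "ip (pd_v y p) (n2 p) = 0"
    "ip (pd_u n1 p) (x p) = - \<epsilon> * N p" "ip (pd_u n1 p) (y p) = 0"
    "ip (pd_u n1 p) (n1 p) = 0" "ip (pd_u n1 p) (n2 p) = - \<epsilon> * b_u p"
    "ip (pd_v n1 p) (x p) = 0" "ip (pd_v n1 p) (y p) = - \<epsilon> * N p"
    "ip (pd_v n1 p) (n1 p) = 0" "ip (pd_v n1 p) (n2 p) = - \<epsilon> * b_v p"
    "ip (pd_u n2 p) (x p) = 0" "ip (pd_u n2 p) (y p) = \<epsilon> * M p"
    "ip (pd_u n2 p) (n1 p) = \<epsilon> * b_u p" "ip (pd_u n2 p) (n2 p) = 0"
    "ip (pd_v n2 p) (x p) = \<epsilon> * M p" "ip (pd_v n2 p) (y p) = 0"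
    "ip (pd_v n2 p) (n1 p) = \<epsilon> * b_v p" "ip (pd_v n2 p) (n2 p) = 0"
proof -
  note const = pd_ip_const[OF _ _ open_U assms]
  note swap = ip_commute[of "x p"] ip_commute[of "y p"] ip_commute[of "n1 p"] ip_commute[of "n2 p"]
  note b = b_u_def[of p] b_v_def[of p] \<alpha>_def[of p] \<beta>_def[of p]
  note known = ip_second_ff[OF assms] mixed(2-4)[OF assms]
  show
    "ip (pd_u x p) (n1 p) = \<epsilon> * N p" "ip (pd_u x p) (n2 p) = 0"
    "ip (pd_v x p) (y p) = - \<alpha> p"
    "ip (pd_v x p) (n1 p) = 0" "ip (pd_v x p) (n2 p) = - \<epsilon> * M p"
    "ip (pd_u y p) (x p) = \<beta> p"
    "ip (pd_u y p) (n1 p) = 0" "ip (pd_u y p) (n2 p) = - \<epsilon> * M p"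
    "ip (pd_v y p) (x p) = \<alpha> p"
    "ip (pd_v y p) (n1 p) = \<epsilon> * N p" "ip (pd_v y p) (n2 p) = 0"
    using known b by simp_all
  show "ip (pd_u n1 p) (n2 p) = - \<epsilon> * b_u p" "ip (pd_v n1 p) (n2 p) = - \<epsilon> * b_v p"
    by (simp_all add: b \<epsilon>_square)
  show "ip (pd_u n2 p) (n1 p) = \<epsilon> * b_u p" "ip (pd_v n2 p) (n1 p) = \<epsilon> * b_v p"
    using const[OF smooth(5,4) gram_swap(2)] swap(4) by (simp_all add: b \<epsilon>_square)
  show "ip (pd_u x p) (x p) = 0" "ip (pd_v x p) (x p) = 0"
    using const[OF smooth(2,2) gram(1)] swap(1) by simp_all
  show "ip (pd_u y p) (y p) = 0" "ip (pd_v y p) (y p) = 0"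
    using const[OF smooth(3,3) gram(2)] swap(2) by simp_all
  show "ip (pd_u n1 p) (n1 p) = 0" "ip (pd_v n1 p) (n1 p) = 0"
    using const[OF smooth(4,4) gram(3)] swap(3) by simp_all
  show "ip (pd_u n2 p) (n2 p) = 0" "ip (pd_v n2 p) (n2 p) = 0"
    using const[OF smooth(5,5) gram(4)] swap(4) by simp_all
  show "ip (pd_u x p) (y p) = - \<beta> p"
    using const(1)[OF smooth(2,3) gram(5)] swap(1) b by simp
  show "ip (pd_u n1 p) (x p) = - \<epsilon> * N p" "ip (pd_v n1 p) (x p) = 0"
    using const[OF smooth(4,2) gram(7)] swap(3) known by simp_all
  show "ip (pd_u n1 p) (y p) = 0" "ip (pd_v n1 p) (y p) = - \<epsilon> * N p"
    using const[OF smooth(4,3) gram(8)] swap(3) known by simp_all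
  show "ip (pd_u n2 p) (x p) = 0" "ip (pd_v n2 p) (x p) = \<epsilon> * M p"
    using const[OF smooth(5,2) gram(9)] swap(4) known by simp_all
  show "ip (pd_u n2 p) (y p) = \<epsilon> * M p" "ip (pd_v n2 p) (y p) = 0"
    using const[OF smooth(5,3) gram(10)] swap(4) known by simp_all
qed

text \<open>Each coefficient is a constant multiple of an inner product of smooth fields. For
  \<open>M\<close> and \<open>N\<close> the table of frame derivatives supplies such a formula, so
  nothing has to be known about derivatives of \<open>\<mu>\<close> and
  \<open>\<nu>\<close>.\<close>

lemma coefficients_differentiable:
  assumes "p \<in> U"
  shows "has_pd \<alpha> p (pd_u \<alpha> p) (pd_v \<alpha> p)" "has_pd \<beta> p (pd_u \<beta> p) (pd_v \<beta> p)"
    "has_pd M p (pd_u M p) (pd_v M p)" "has_pd N p (pd_u N p) (pd_v N p)"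
    "has_pd b_u p (pd_u b_u p) (pd_v b_u p)" "has_pd b_v p (pd_u b_v p) (pd_v b_v p)"
proof -
  have *: "has_pd f p (pd_u f p) (pd_v f p)"
    if "smooth_on U a" "smooth_on U b" "\<And>q. q \<in> U \<Longrightarrow> f q = k * ip (a q) (b q)" for f a b k
    by (rule differentiable_has_pd, rule has_pd_differentiable,
        rule has_pd_transform[OF _ open_U assms that(3)],
        rule has_pd_cmult[OF has_pd_ip[OF has_pd[OF that(1) assms] has_pd[OF that(2) assms]]])
  note sm = smooth smooth(2-5)[THEN smooth_on_pd(1)] smooth(2-5)[THEN smooth_on_pd(2)]
  show "has_pd \<alpha> p (pd_u \<alpha> p) (pd_v \<alpha> p)"
    by (rule *[of "pd_v y" x _ 1]) (simp_all add: sm \<alpha>_def)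
  show "has_pd \<beta> p (pd_u \<beta> p) (pd_v \<beta> p)"
    by (rule *[of "pd_u y" x _ 1]) (simp_all add: sm \<beta>_def)
  show "has_pd M p (pd_u M p) (pd_v M p)"
    by (rule *[of "pd_u y" n2 _ "- \<epsilon>"]) (simp_all add: sm frame_derivs \<epsilon>_square)
  show "has_pd N p (pd_u N p) (pd_v N p)"
    by (rule *[of "pd_u x" n1 _ "\<epsilon>"]) (simp_all add: sm frame_derivs \<epsilon>_square)
  show "has_pd b_u p (pd_u b_u p) (pd_v b_u p)"
    by (rule *[of "pd_u n1" n2 _ "- \<epsilon>"]) (simp_all add: sm b_u_def)
  show "has_pd b_v p (pd_u b_v p) (pd_v b_v p)"
    by (rule *[of "pd_v n1" n2 _ "- \<epsilon>"]) (simp_all add: sm b_v_def)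
qed

section \<open>The Gauss, Ricci and Codazzi equations\<close>

lemma gauss_equation:
  assumes "p \<in> U"
  shows "pd_u \<alpha> p - pd_v \<beta> p = \<epsilon> * ((M p)\<^sup>2 + (N p)\<^sup>2)"
proof -
  note d = coefficients_differentiable[OF assms]
  have "- 1 * pd_v \<beta> p - - 1 * pd_u \<alpha> p = ip (pd_u x p) (pd_v y p) - ip (pd_v x p) (pd_u y p)"
    by (rule pd_ip_integrability[OF smooth(2,3) open_U assms _ has_pd_cmult[OF d(2)] _ has_pd_cmult[OF d(1)]])
      (simp_all add: frame_derivs)
  \<comment> \<open>Derivatives of \<open>x\<close> have no \<open>x\<close> component and those of
    \<open>y\<close> no \<open>y\<close> component, so only the normal products survive.\<close>
  also have "\<dots> = \<epsilon> * ((M p)\<^sup>2 + (N p)\<^sup>2)"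
    by (subst (1 2) ip_expansion[OF assms])
      (simp add: frame_derivs[OF assms] \<epsilon>_square power2_eq_square algebra_simps)
  finally show ?thesis
    by simp
qed

text \<open>Integrability for the pair \<open>n1\<close>, \<open>n2\<close>; here the normal
  products vanish and the tangential ones give the curvature of the form \<open>b\<close>.\<close>

lemma ricci_equation:
  assumes "p \<in> U"
  shows "pd_u b_v p - pd_v b_u p = - 2 * \<epsilon> * (M p * N p)"
proof -
  note d = coefficients_differentiable[OF assms]
  have "- \<epsilon> * pd_v b_u p - - \<epsilon> * pd_u b_v p = ip (pd_u n1 p) (pd_v n2 p) - ip (pd_v n1 p) (pd_u n2 p)"
    by (rule pd_ip_integrability[OF smooth(4,5) open_U assms _ has_pd_cmult[OF d(5)] _ has_pd_cmult[OF d(6)]])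
      (simp_all add: frame_derivs)
  also have "\<dots> = - 2 * (M p * N p)"
    by (subst (1 2) ip_expansion[OF assms])
      (simp add: frame_derivs[OF assms] \<epsilon>_square power2_eq_square algebra_simps)
  finally show ?thesis
    using \<epsilon> by auto
qed

text \<open>Integrability for the four pairs of a tangent and a normal frame field. In each pair one
  of the two differentiated products is identically zero, so exactly one derivative of
  \<open>M\<close> or \<open>N\<close> remains.\<close>

lemma codazzi_equations:
  assumes "p \<in> U"
  shows "pd_u M p = N p * b_v p - \<alpha> p * M p" "pd_v M p = N p * b_u p - \<beta> p * M p"
    "pd_u N p = M p * b_v p - \<alpha> p * N p" "pd_v N p = M p * b_u p - \<beta> p * N p"
proof -
  note d = coefficients_differentiable[OF assms]
  note zero = has_pd_const[of "0 :: real" p]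
  have "\<epsilon> * pd_v N p - 0 = ip (pd_u x p) (pd_v n1 p) - ip (pd_v x p) (pd_u n1 p)"
    by (rule pd_ip_integrability[OF smooth(2,4) open_U assms _ has_pd_cmult[OF d(4)] _ zero])
      (simp_all add: frame_derivs)
  also have "\<dots> = \<epsilon> * (M p * b_u p - \<beta> p * N p)"
    by (subst (1 2) ip_expansion[OF assms])
      (simp add: frame_derivs[OF assms] \<epsilon>_square algebra_simps)
  finally show "pd_v N p = M p * b_u p - \<beta> p * N p"
    using \<epsilon> by auto
  have "0 - - \<epsilon> * pd_u M p = ip (pd_u x p) (pd_v n2 p) - ip (pd_v x p) (pd_u n2 p)"
    by (rule pd_ip_integrability[OF smooth(2,5) open_U assms _ zero _ has_pd_cmult[OF d(3)]])
      (simp_all add: frame_derivs)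
  also have "\<dots> = \<epsilon> * (N p * b_v p - \<alpha> p * M p)"
    by (subst (1 2) ip_expansion[OF assms])
      (simp add: frame_derivs[OF assms] \<epsilon>_square algebra_simps)
  finally show "pd_u M p = N p * b_v p - \<alpha> p * M p"
    using \<epsilon> by auto
  have "0 - \<epsilon> * pd_u N p = ip (pd_u y p) (pd_v n1 p) - ip (pd_v y p) (pd_u n1 p)"
    by (rule pd_ip_integrability[OF smooth(3,4) open_U assms _ zero _ has_pd_cmult[OF d(4)]])
      (simp_all add: frame_derivs)
  also have "\<dots> = - \<epsilon> * (M p * b_v p - \<alpha> p * N p)"
    by (subst (1 2) ip_expansion[OF assms])
      (simp add: frame_derivs[OF assms] \<epsilon>_square algebra_simps)
  finally show "pd_u N p = M p * b_v p - \<alpha> p * N p"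
    using \<epsilon> by auto
  have "- \<epsilon> * pd_v M p - 0 = ip (pd_u y p) (pd_v n2 p) - ip (pd_v y p) (pd_u n2 p)"
    by (rule pd_ip_integrability[OF smooth(3,5) open_U assms _ has_pd_cmult[OF d(3)] _ zero])
      (simp_all add: frame_derivs)
  also have "\<dots> = - \<epsilon> * (N p * b_u p - \<beta> p * M p)"
    by (subst (1 2) ip_expansion[OF assms])
      (simp add: frame_derivs[OF assms] \<epsilon>_square algebra_simps)
  finally show "pd_v M p = N p * b_u p - \<beta> p * M p"
    using \<epsilon> by auto
qed


subsection \<open>The curvatures\<close>

lemma has_pd_inverse_e:
  assumes "p \<in> U"
  shows "has_pd (\<lambda>q. 1 / e q) p (- \<alpha> p / e p) (- \<beta> p / e p)"
proof -
  have "((\<lambda>t. 1 / t) has_real_derivative - (1 / (e p)\<^sup>2)) (at (e p))"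
    using e_pos[OF assms] by (auto intro!: derivative_eq_intros simp: power2_eq_square)
  from has_pd_chain[OF mixed(1)[OF assms] this] show ?thesis
    using e_pos[OF assms] by (simp add: power2_eq_square)
qed

lemma normal_conn_frame:
  assumes "p \<in> U"
  shows "normal_conn z x n1 p = (b_u p * (1 / e p)) *\<^sub>R n2 p"
    "normal_conn z y n1 p = (b_v p * (1 / e p)) *\<^sub>R n2 p"
  unfolding normal_conn_def ambient_deriv_frame[OF assms has_pd[OF smooth(4) assms]]
    normal_part_eq[OF assms]
  by (simp_all add: ip_simps frame_derivs assms \<epsilon>_square)

text \<open>In the parameter plane \<open>x\<close> and \<open>y\<close> are the coordinate fields
  divided by \<open>e\<close>, so the bracket consists of the derivatives of
  \<open>1 / e\<close>.\<close>

lemma lie_bracket_frame: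
  assumes "p \<in> U"
  shows "coords z (lie_bracket z x y) p = (\<beta> p / (e p)\<^sup>2, - \<alpha> p / (e p)\<^sup>2)"
proof -
  have "bounded_linear (\<lambda>t :: real. (t, 0 :: real))" "bounded_linear (\<lambda>t :: real. (0 :: real, t))"
    by (intro bounded_linear_Pair bounded_linear_ident bounded_linear_zero)+
  note pd = this[THEN has_pd_linear, OF has_pd_inverse_e[OF assms]]
  have "has_pd (coords z x) p (- \<alpha> p / e p, 0) (- \<beta> p / e p, 0)"
    "has_pd (coords z y) p (0, - \<alpha> p / e p) (0, - \<beta> p / e p)"
    by (rule has_pd_transform[OF pd(1) open_U assms] has_pd_transform[OF pd(2) open_U assms],
        simp add: coords_frame)+
  note fd = this[THEN has_pd_frechet_derivative]
  show ?thesis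
    by (rule coords_eq[OF assms])
      (simp add: lie_bracket_def fd coords_frame assms power2_eq_square)
qed

lemma normal_curvature_eq:
  assumes "p \<in> U"
  shows "normal_curvature z x y n1 n2 p = - 2 * (\<mu> p * \<nu> p)"
proof -
  note d = coefficients_differentiable[OF assms]
  note n2 = has_pd[OF smooth(5) assms]
  have xn: "has_pd (normal_conn z x n1) p
      ((b_u p * (1 / e p)) *\<^sub>R pd_u n2 p + (b_u p * (- \<alpha> p / e p) + pd_u b_u p * (1 / e p)) *\<^sub>R n2 p)
      ((b_u p * (1 / e p)) *\<^sub>R pd_v n2 p + (b_u p * (- \<beta> p / e p) + pd_v b_u p * (1 / e p)) *\<^sub>R n2 p)"
    by (rule has_pd_transform[OF has_pd_scaleR[OF has_pd_mult[OF d(5) has_pd_inverse_e[OF assms]] n2]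
          open_U assms]) (simp add: normal_conn_frame)
  have yn: "has_pd (normal_conn z y n1) p
      ((b_v p * (1 / e p)) *\<^sub>R pd_u n2 p + (b_v p * (- \<alpha> p / e p) + pd_u b_v p * (1 / e p)) *\<^sub>R n2 p)
      ((b_v p * (1 / e p)) *\<^sub>R pd_v n2 p + (b_v p * (- \<beta> p / e p) + pd_v b_v p * (1 / e p)) *\<^sub>R n2 p)"
    by (rule has_pd_transform[OF has_pd_scaleR[OF has_pd_mult[OF d(6) has_pd_inverse_e[OF assms]] n2]
          open_U assms]) (simp add: normal_conn_frame)
  have 1: "ip (normal_conn z x (normal_conn z y n1) p) (n2 p)
      = - \<epsilon> * (pd_u b_v p - \<alpha> p * b_v p) / (e p)\<^sup>2"
    unfolding normal_conn_def[of z x "normal_conn z y n1"] ip_normal_part[OF assms]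
      ambient_deriv_frame(1)[OF assms yn]
    by (simp add: ip_simps gram frame_derivs assms power2_eq_square algebra_simps diff_divide_distrib add_divide_distrib)
  have 2: "ip (normal_conn z y (normal_conn z x n1) p) (n2 p)
      = - \<epsilon> * (pd_v b_u p - \<beta> p * b_u p) / (e p)\<^sup>2"
    unfolding normal_conn_def[of z y "normal_conn z x n1"] ip_normal_part[OF assms]
      ambient_deriv_frame(2)[OF assms xn]
    by (simp add: ip_simps gram frame_derivs assms power2_eq_square algebra_simps diff_divide_distrib add_divide_distrib)
  have 3: "ip (normal_conn z (lie_bracket z x y) n1 p) (n2 p)
      = - \<epsilon> * (\<beta> p * b_u p - \<alpha> p * b_v p) / (e p)\<^sup>2"
    unfolding normal_conn_def ip_normal_part[OF assms] ambient_deriv_def lie_bracket_frame[OF assms]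
      has_pd_frechet_derivative[OF has_pd[OF smooth(4) assms]]
    by (simp add: ip_simps frame_derivs assms algebra_simps diff_divide_distrib)
  \<comment> \<open>The bracket term cancels the contributions from differentiating
    \<open>1 / e\<close>, leaving the exterior derivative of the connection form.\<close>
  have "ip (normal_curv_tensor z x y n1 p) (n2 p) = - \<epsilon> * (pd_u b_v p - pd_v b_u p) / (e p)\<^sup>2"
    unfolding normal_curv_tensor_def ip.diff_left 1 2 3
    by (simp add: algebra_simps diff_divide_distrib add_divide_distrib)
  also have "\<dots> = 2 * (\<mu> p * \<nu> p)"
    unfolding ricci_equation[OF assms] M_def N_def
    using e_pos[OF assms] \<epsilon> by (auto simp: power2_eq_square)
  finally show ?thesis
    unfolding normal_curvature_def by (simp add: gram assms)
qed

text \<open>Squaring removes the absolute value in the canonical normalization; the fourth power on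
  the right prepares the fourth root.\<close>

lemma e_power8:
  assumes "p \<in> U"
  shows "(((\<mu> p)\<^sup>2 - (\<nu> p)\<^sup>2))\<^sup>2 = (1 / (e p)\<^sup>2) ^ 4"
proof -
  have "\<bar>(\<mu> p)\<^sup>2 - (\<nu> p)\<^sup>2\<bar> = 1 / e p ^ 4"
    using e_power4[OF assms] e_pos[OF assms] by (simp add: field_simps)
  then have "\<bar>(\<mu> p)\<^sup>2 - (\<nu> p)\<^sup>2\<bar>\<^sup>2 = (1 / e p ^ 4)\<^sup>2"
    by simp
  then show ?thesis
    by (simp add: power_divide flip: power_mult)
qed

lemma curvatures:
  assumes "p \<in> U"
  defines "K \<equiv> gauss_curvature z x y p" and "\<kappa> \<equiv> normal_curvature z x y n1 n2 p"
  shows "K\<^sup>2 - \<kappa>\<^sup>2 = (1 / (e p)\<^sup>2) ^ 4"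
    "(K + \<epsilon> * \<kappa>) / (K - \<epsilon> * \<kappa>) = (e p * (M p + N p)) ^ 4"
proof -
  note K\<kappa> = K_def[unfolded gauss_curvature_eq[OF assms(1)]] \<kappa>_def[unfolded normal_curvature_eq[OF assms(1)]]
  have "K\<^sup>2 - \<kappa>\<^sup>2 = ((\<mu> p)\<^sup>2 - (\<nu> p)\<^sup>2)\<^sup>2"
    unfolding K\<kappa> using \<epsilon> by (auto simp: power2_eq_square algebra_simps)
  then show "K\<^sup>2 - \<kappa>\<^sup>2 = (1 / (e p)\<^sup>2) ^ 4"
    by (simp add: e_power8 assms(1))
  \<comment> \<open>\<open>K + \<epsilon> * \<kappa>\<close> and
    \<open>K - \<epsilon> * \<kappa>\<close> are \<open>- \<epsilon>\<close> times the squares of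
    \<open>s\<close> and \<open>d\<close>.\<close>
  define s d where "s = \<mu> p + \<nu> p" and "d = \<mu> p - \<nu> p"
  have "(e p)\<^sup>2 > 0"
    using e_pos[OF assms(1)] by simp
  have "(s * d)\<^sup>2 = (1 / (e p)\<^sup>2) ^ 4"
    unfolding e_power8[OF assms(1), symmetric] s_def d_def by (simp add: power2_eq_square algebra_simps)
  then have sd: "s\<^sup>2 * d\<^sup>2 * ((e p)\<^sup>2) ^ 4 = 1"
    using \<open>(e p)\<^sup>2 > 0\<close> by (simp add: power_mult_distrib power_divide)
  then have "d \<noteq> 0"
    by auto
  have "(K + \<epsilon> * \<kappa>) / (K - \<epsilon> * \<kappa>) = (- \<epsilon> * s\<^sup>2) / (- \<epsilon> * d\<^sup>2)"
    unfolding K\<kappa> s_def d_def by (simp add: power2_eq_square algebra_simps)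
  also have "\<dots> = s\<^sup>2 / d\<^sup>2"
    using \<epsilon> by auto
  \<comment> \<open>Inserting the factor \<open>1\<close> from \<open>sd\<close> cancels the
    denominator and completes a fourth power.\<close>
  also have "\<dots> = s\<^sup>2 * (s\<^sup>2 * d\<^sup>2 * ((e p)\<^sup>2) ^ 4) / d\<^sup>2"
    unfolding sd by simp
  also have "\<dots> = ((e p)\<^sup>2 * s) ^ 4"
    using \<open>d \<noteq> 0\<close> by (simp add: power_mult_distrib)
  also have "(e p)\<^sup>2 * s = e p * (M p + N p)"
    unfolding M_def N_def s_def by (simp add: power2_eq_square algebra_simps)
  finally show "(K + \<epsilon> * \<kappa>) / (K - \<epsilon> * \<kappa>) = (e p * (M p + N p)) ^ 4" .
qed

lemma e_sum_nonzero:
  assumes "p \<in> U"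
  shows "e p * (M p + N p) \<noteq> 0"
proof -
  have "\<mu> p + \<nu> p \<noteq> 0"
  proof
    assume "\<mu> p + \<nu> p = 0"
    then have "\<mu> p = - \<nu> p"
      by simp
    then show False
      using e_power4[OF assms] by simp
  qed
  then show ?thesis
    using e_pos[OF assms] by (simp add: M_def N_def flip: distrib_left)
qed

section \<open>The logarithms and their hyperbolic Laplacians\<close>

lemma has_pd_ln_e:
  assumes "p \<in> U"
  shows "has_pd (\<lambda>q. ln (e q)) p (\<alpha> p) (\<beta> p)"
  using has_pd_chain[OF mixed(1) DERIV_ln, OF assms e_pos] e_pos[OF assms] assms
  by (simp add: mult.assoc[symmetric])

text \<open>By the Codazzi equations \<open>S = e (M + N)\<close> satisfies \<open>S\<^sub>u = b\<^sub>v S\<close> and \<open>S\<^sub>v = b\<^sub>u S\<close>.\<close>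

lemma has_pd_ln_e_sum:
  assumes "p \<in> U"
  shows "has_pd (\<lambda>q. ln ((e q * (M q + N q)) ^ 4)) p (4 * b_v p) (4 * b_u p)"
proof -
  let ?S = "\<lambda>q. e q * (M q + N q)"
  note d = coefficients_differentiable[OF assms]
  have S: "has_pd ?S p (b_v p * ?S p) (b_u p * ?S p)"
    using has_pd_mult[OF mixed(1)[OF assms] has_pd_add[OF d(3,4)]]
    unfolding codazzi_equations[OF assms] by (simp add: algebra_simps)
  \<comment> \<open>The even power makes this valid for either sign of \<open>?S p\<close>; only
    \<open>?S p \<noteq> 0\<close> matters.\<close>
  have "((\<lambda>t. ln (t ^ 4)) has_real_derivative 4 / ?S p) (at (?S p))"
    using e_sum_nonzero[OF assms]
    by (auto intro!: derivative_eq_intros simp: zero_less_power_eq) (simp add: eval_nat_numeral)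
  from has_pd_chain[OF S this] show ?thesis
    using e_sum_nonzero[OF assms] by simp
qed

theorem canonical_pde:
  assumes "p \<in> U"
  defines "K \<equiv> gauss_curvature z x y" and "\<kappa> \<equiv> normal_curvature z x y n1 n2"
  shows "root 4 ((K p)\<^sup>2 - (\<kappa> p)\<^sup>2) * hyp_laplacian (\<lambda>q. ln ((K q)\<^sup>2 - (\<kappa> q)\<^sup>2)) p = 8 * K p"
    "root 4 ((K p)\<^sup>2 - (\<kappa> p)\<^sup>2)
        * hyp_laplacian (\<lambda>q. ln ((K q + \<epsilon> * \<kappa> q) / (K q - \<epsilon> * \<kappa> q))) p = 4 * \<epsilon> * \<kappa> p"
proof -
  note d = coefficients_differentiable[OF assms(1)]
  note K\<kappa> = curvatures[folded K_def \<kappa>_def]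
  have root: "root 4 ((K p)\<^sup>2 - (\<kappa> p)\<^sup>2) = 1 / (e p)\<^sup>2"
    unfolding K\<kappa>[OF assms(1)] by (rule real_root_power_cancel) simp_all
  have lnK: "ln ((K q)\<^sup>2 - (\<kappa> q)\<^sup>2) = - 8 * ln (e q)" if "q \<in> U" for q
    using e_pos[OF that] unfolding K\<kappa>[OF that] by (simp add: ln_realpow ln_div)
  have "has_pd (\<lambda>q. ln ((K q)\<^sup>2 - (\<kappa> q)\<^sup>2)) q (- 8 * \<alpha> q) (- 8 * \<beta> q)" if "q \<in> U" for q
    using has_pd_transform[OF has_pd_cmult[OF has_pd_ln_e[OF that]] open_U that lnK] .
  from hyp_laplacian_eq[OF open_U assms(1) this has_pd_cmult[OF d(1)] has_pd_cmult[OF d(2)]]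
  have "hyp_laplacian (\<lambda>q. ln ((K q)\<^sup>2 - (\<kappa> q)\<^sup>2)) p = - 8 * (pd_u \<alpha> p - pd_v \<beta> p)"
    by simp
  also have "\<dots> = 8 * (e p)\<^sup>2 * K p"
    unfolding gauss_equation[OF assms(1)] M_def N_def K_def gauss_curvature_eq[OF assms(1)]
    by (simp add: power_mult_distrib algebra_simps)
  finally show "root 4 ((K p)\<^sup>2 - (\<kappa> p)\<^sup>2) * hyp_laplacian (\<lambda>q. ln ((K q)\<^sup>2 - (\<kappa> q)\<^sup>2)) p = 8 * K p"
    unfolding root using e_pos[OF assms(1)] by simp
  have "has_pd (\<lambda>q. ln ((K q + \<epsilon> * \<kappa> q) / (K q - \<epsilon> * \<kappa> q))) q (4 * b_v q) (4 * b_u q)" if "q \<in> U" for q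
    by (rule has_pd_transform[OF has_pd_ln_e_sum[OF that] open_U that]) (simp only: K\<kappa>)
  \<comment> \<open>Because \<open>b_v\<close> is the \<open>u\<close> derivative and
    \<open>b_u\<close> the \<open>v\<close> derivative, up to the factor 4, the Laplacian is the
    left side of the Ricci equation.\<close>
  from hyp_laplacian_eq[OF open_U assms(1) this has_pd_cmult[OF d(6)] has_pd_cmult[OF d(5)]]
  have "hyp_laplacian (\<lambda>q. ln ((K q + \<epsilon> * \<kappa> q) / (K q - \<epsilon> * \<kappa> q))) p
      = 4 * (pd_u b_v p - pd_v b_u p)"
    by simp
  also have "\<dots> = (e p)\<^sup>2 * (4 * \<epsilon> * \<kappa> p)"
    unfolding ricci_equation[OF assms(1)] M_def N_def \<kappa>_def normal_curvature_eq[OF assms(1)]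
    by (simp add: power2_eq_square)
  finally show "root 4 ((K p)\<^sup>2 - (\<kappa> p)\<^sup>2)
      * hyp_laplacian (\<lambda>q. ln ((K q + \<epsilon> * \<kappa> q) / (K q - \<epsilon> * \<kappa> q))) p = 4 * \<epsilon> * \<kappa> p"
    unfolding root using e_pos[OF assms(1)] by simp
qed

end

theorem mainTheorem3:
  fixes U :: "(real \<times> real) set"
    and z x y n1 n2 :: "real \<times> real \<Rightarrow> real ^ 4"
    and \<epsilon> :: real
    and \<mu> \<nu> K \<kappa> :: "real \<times> real \<Rightarrow> real"
  assumes "open U"
    and "general_type U z"
    and "geometric_frame U z \<epsilon> x y n1 n2 \<mu> \<nu>"
    and "canonical_parameters U z x y \<mu> \<nu>"
    and "K = gauss_curvature z x y"
    and "\<kappa> = normal_curvature z x y n1 n2"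
    and "\<And>p. p \<in> U \<Longrightarrow> (K p)\<^sup>2 - (\<kappa> p)\<^sup>2 > 0"
  shows "\<forall>p\<in>U.
      root 4 ((K p)\<^sup>2 - (\<kappa> p)\<^sup>2) * hyp_laplacian (\<lambda>q. ln ((K q)\<^sup>2 - (\<kappa> q)\<^sup>2)) p = 8 * K p \<and>
      root 4 ((K p)\<^sup>2 - (\<kappa> p)\<^sup>2)
        * hyp_laplacian (\<lambda>q. ln ((K q + \<epsilon> * \<kappa> q) / (K q - \<epsilon> * \<kappa> q))) p = 4 * \<epsilon> * \<kappa> p"
proof -
  interpret canonical_surface U z x y n1 n2 \<epsilon> \<mu> \<nu>
    using assms(1-4) by unfold_locales (simp_all add: general_type_def minimal_lorentz_surface_def)
  show ?thesis
    unfolding assms(5,6) using canonical_pde by blast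
qed

end
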